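(* Let $K$ be a finite connected simplicial complex and let $L$ be a non-empty categorical subcomplex of $K$. Then $TC(K,L)=scat(K)$.
   Context: Simplicial complexes are abstract simplicial complexes. The categorical product $K\prod L$ of simplicial complexes has vertex set $V(K)\times V(L)$, and a finite set $\sigma$ of vertices is a simplex iff its projections $p_1(\sigma)$ and $p_2(\sigma)$ are simplices of $K$ and $L$ respectively. Two simplicial maps $\phi,\psi:K\to M$ are contiguous, $\phi\sim_c\psi$, if $\phi(\sigma)\cup\psi(\sigma)$ is a simplex of $M$ for every simplex $\sigma$ of $K$. They are in the same contiguity class, $\phi\sim\psi$, if there is a finite sequence of simplicial maps $\phi=\phi_0\sim_c\phi_1\sim_c\cdots\sim_c\phi_n=\psi$. For a subcomplex $L\subseteq K$, the targeted simplicial complexity $TC(K,L)$ is the least integer $n\ge 0$ such that $K\prod L$ can be covered by $n+1$ subcomplexes $\Omega_0,\dots,\Omega_n$ such that for each $i$ there is a simplicial map $\sigma_i:\Omega_i\to L$ with $\Delta_L\circ\sigma_i\sim i_{\Omega_i}$, where $\Delta_L:L\to K\prod L$, $\Delta_L(v)=(v,v)$, and $i_{\Omega_i}:\Omega_i\to K\prod L$ is the inclusion. A subcomplex $U\subseteq K$ is categorical if there is a vertex $v\in K$ such that the inclusion $U\hookrightarrow K$ and the constant map $c_v:U\to K$ are in the same contiguity class. The simplicial LS-category $scat(K)$ is the least integer $n\ge 0$ such that $K$ can be covered by $n+1$ categorical subcomplexes. *)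

theory Defs
  imports Main "HOL-Library.Extended_Nat"
begin

text \<open>
  An abstract simplicial complex is the set of its simplices. Simplices are non-empty, so the
  empty complex is \<open>{}\<close>, and the vertices are the elements of the simplices.
\<close>

definition simplicial_complex :: "'a set set \<Rightarrow> bool" where
  "simplicial_complex K \<longleftrightarrow>
     (\<forall>s\<in>K. finite s \<and> s \<noteq> {}) \<and> (\<forall>s\<in>K. \<forall>t. t \<subseteq> s \<and> t \<noteq> {} \<longrightarrow> t \<in> K)"

definition vertices :: "'a set set \<Rightarrow> 'a set" where
  "vertices K = \<Union>K"

definition subcomplex :: "'a set set \<Rightarrow> 'a set set \<Rightarrow> bool" where
  "subcomplex L K \<longleftrightarrow> simplicial_complex L \<and> L \<subseteq> K"

definition connected_complex :: "'a set set \<Rightarrow> bool" where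
  "connected_complex K \<longleftrightarrow>
     (\<forall>u\<in>vertices K. \<forall>v\<in>vertices K. (\<lambda>x y. {x, y} \<in> K)\<^sup>*\<^sup>* u v)"

definition cat_product :: "'a set set \<Rightarrow> 'b set set \<Rightarrow> ('a \<times> 'b) set set" where
  "cat_product K L =
     {s. s \<subseteq> vertices K \<times> vertices L \<and> finite s \<and> fst ` s \<in> K \<and> snd ` s \<in> L}"

text \<open>
  A vertex map is a total function of which only the values on \<open>vertices K\<close> matter.
\<close>

definition simplicial_map :: "'a set set \<Rightarrow> 'b set set \<Rightarrow> ('a \<Rightarrow> 'b) \<Rightarrow> bool" where
  "simplicial_map K M f \<longleftrightarrow> (\<forall>s\<in>K. f ` s \<in> M)"

definition contiguous :: "'a set set \<Rightarrow> 'b set set \<Rightarrow> ('a \<Rightarrow> 'b) \<Rightarrow> ('a \<Rightarrow> 'b) \<Rightarrow> bool" where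
  "contiguous K M f g \<longleftrightarrow>
     simplicial_map K M f \<and> simplicial_map K M g \<and> (\<forall>s\<in>K. f ` s \<union> g ` s \<in> M)"

text \<open>
  The first conjunct is needed only for the chain of length \<open>0\<close>. The values of \<open>f\<close> and \<open>g\<close>
  outside \<open>vertices K\<close> are irrelevant here too, since simplicial maps that agree on
  \<open>vertices K\<close> are contiguous.
\<close>

definition same_contiguity_class ::
    "'a set set \<Rightarrow> 'b set set \<Rightarrow> ('a \<Rightarrow> 'b) \<Rightarrow> ('a \<Rightarrow> 'b) \<Rightarrow> bool" where
  "same_contiguity_class K M f g \<longleftrightarrow> simplicial_map K M f \<and> (contiguous K M)\<^sup>*\<^sup>* f g"

lemma contiguous_if_agree:
  assumes "simplicial_map K M f" and "\<And>v. v \<in> vertices K \<Longrightarrow> f v = g v"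
  shows "contiguous K M f g"
proof -
  have "f ` s = g ` s" if "s \<in> K" for s
    using that assms(2) by (intro image_cong) (auto simp: vertices_def)
  then show ?thesis
    using assms(1) by (simp add: contiguous_def simplicial_map_def)
qed

lemma simplicial_complex_cat_product:
  assumes "simplicial_complex K" and "simplicial_complex L"
  shows "simplicial_complex (cat_product K L)"
  unfolding simplicial_complex_def
proof (intro conjI ballI allI impI)
  fix s assume s: "s \<in> cat_product K L"
  show "finite s"
    using s by (simp add: cat_product_def)
  show "s \<noteq> {}"
    using s assms by (auto simp: cat_product_def simplicial_complex_def)
  fix t assume t: "t \<subseteq> s \<and> t \<noteq> {}"
  have "fst ` t \<in> K" "snd ` t \<in> L"
    using s t assms unfolding cat_product_def simplicial_complex_def
    by (metis (no_types, lifting) image_is_empty image_mono mem_Collect_eq)+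
  then show "t \<in> cat_product K L"
    using s t by (auto simp: cat_product_def intro: finite_subset)
qed

text \<open>
  In the two invariants below, the least \<open>n\<close> is taken in \<^typ>\<open>enat\<close>, so it is \<open>\<infinity>\<close> if there
  is no cover of the required kind.
\<close>

definition targeted_complexity :: "'a set set \<Rightarrow> 'a set set \<Rightarrow> enat" where
  "targeted_complexity K L =
     Inf {enat n | n. \<exists>\<Omega>.
       (\<forall>i\<le>n. subcomplex (\<Omega> i) (cat_product K L) \<and>
          (\<exists>\<sigma>. simplicial_map (\<Omega> i) L \<sigma> \<and>
             same_contiguity_class (\<Omega> i) (cat_product K L) ((\<lambda>v. (v, v)) \<circ> \<sigma>) (\<lambda>x. x))) \<and>
       (\<Union>i\<le>n. \<Omega> i) = cat_product K L}"

definition categorical :: "'a set set \<Rightarrow> 'a set set \<Rightarrow> bool" where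
  "categorical U K \<longleftrightarrow>
     subcomplex U K \<and> (\<exists>v\<in>vertices K. same_contiguity_class U K (\<lambda>x. x) (\<lambda>_. v))"

definition scat :: "'a set set \<Rightarrow> enat" where
  "scat K = Inf {enat n | n. \<exists>U. (\<forall>i\<le>n. categorical (U i) K) \<and> (\<Union>i\<le>n. U i) = K}"

end

theory Submission imports Defs begin

text \<open>
  A cover of \<open>K\<close> by categorical subcomplexes and a cover of \<open>cat_product K L\<close> by subcomplexes
  with motion planners can be turned into each other without changing the number of pieces.

  The key observation concerns a subcomplex \<open>\<Omega>\<close> of the product on which the two projections,
  read as maps into \<open>K\<close>, are in the same contiguity class. Then the second projection
  is itself a motion planner with target \<open>L\<close>: the diagonal after it is
  \<open>p \<mapsto> (snd p, snd p)\<close>, the inclusion is \<open>p \<mapsto> (fst p, snd p)\<close>, and the two differ only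
  in the first coordinate, which is free to move in all of \<open>K\<close>. This is why it is enough that
  \<open>L\<close> contracts in \<open>K\<close>, although a planner has to take its values in \<open>L\<close>.

  If \<open>U\<close> is categorical, the projections agree up to contiguity on \<open>cat_product U L\<close>: the first
  one contracts because \<open>U\<close> does, the second one because \<open>L\<close> does, and the two constants
  are joined by an edge path in the connected complex \<open>K\<close>
  (\<open>snd_planner_on_categorical_product\<close>). Conversely, if \<open>\<Omega>\<close> carries a planner, then its
  slice at a vertex \<open>w\<close> of \<open>L\<close> is categorical: on the slice the first projection is the
  inclusion, the second one is constant, and the planner lies in the class of both
  (\<open>slice_categorical\<close>).
\<close>

section \<open>Contiguity classes\<close>

lemma contiguous_refl_iff: "contiguous K M f f \<longleftrightarrow> simplicial_map K M f"
  by (auto simp: contiguous_def simplicial_map_def)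

lemma contiguous_sym: "contiguous K M f g \<Longrightarrow> contiguous K M g f"
  by (auto simp: contiguous_def Un_commute)

lemma same_contiguity_class_trans:
  "same_contiguity_class K M f g \<Longrightarrow> same_contiguity_class K M g h
    \<Longrightarrow> same_contiguity_class K M f h"
  by (auto simp: same_contiguity_class_def)

lemma same_contiguity_class_sym:
  assumes "same_contiguity_class K M f g"
  shows "same_contiguity_class K M g f"
proof -
  have fg: "(contiguous K M)\<^sup>*\<^sup>* f g" and f: "simplicial_map K M f"
    using assms by (auto simp: same_contiguity_class_def)
  from fg have "simplicial_map K M g \<and> (contiguous K M)\<^sup>*\<^sup>* g f"
  proof induction
    case base
    show ?case using f by simp
  next
    case (step g h)
    then show ?case
      by (meson contiguous_def contiguous_sym converse_rtranclp_into_rtranclp)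
  qed
  then show ?thesis by (simp add: same_contiguity_class_def)
qed

text \<open>
  An operation on vertex maps only has to be checked on one contiguity at a time; a chain of
  contiguities is then carried over link by link.
\<close>

lemma same_contiguity_class_map:
  assumes "\<And>f g. contiguous K M f g \<Longrightarrow> contiguous K' M' (F f) (F g)"
    and "same_contiguity_class K M f g"
  shows "same_contiguity_class K' M' (F f) (F g)"
proof -
  have "(contiguous K M)\<^sup>*\<^sup>* f g" and "simplicial_map K M f"
    using assms(2) by (auto simp: same_contiguity_class_def)
  moreover from this(1) have "(contiguous K' M')\<^sup>*\<^sup>* (F f) (F g)"
    by induction (auto intro: assms(1) rtranclp.rtrancl_into_rtrancl)
  ultimately show ?thesis
    using assms(1)[of f f] by (simp add: same_contiguity_class_def contiguous_refl_iff)
qed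

lemma same_contiguity_class_precompose:
  assumes "simplicial_map K' K h" and "same_contiguity_class K M f g"
  shows "same_contiguity_class K' M (f \<circ> h) (g \<circ> h)"
proof (rule same_contiguity_class_map[where F = "\<lambda>f. f \<circ> h", OF _ assms(2)])
  fix f g assume "contiguous K M f g"
  then show "contiguous K' M (f \<circ> h) (g \<circ> h)"
    using assms(1) unfolding contiguous_def simplicial_map_def image_comp[symmetric] by blast
qed

lemma same_contiguity_class_postcompose:
  assumes "simplicial_map M M' h" and "same_contiguity_class K M f g"
  shows "same_contiguity_class K M' (h \<circ> f) (h \<circ> g)"
proof (rule same_contiguity_class_map[where F = "\<lambda>f. h \<circ> f", OF _ assms(2)])
  fix f g assume "contiguous K M f g"
  then show "contiguous K M' (h \<circ> f) (h \<circ> g)"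
    using assms(1)
    unfolding contiguous_def simplicial_map_def image_comp[symmetric] image_Un[symmetric] by blast
qed

text \<open>Each edge of an edge path gives one contiguity of constant maps.\<close>

lemma constants_same_contiguity_class:
  assumes "simplicial_complex K" and "connected_complex K" and "simplicial_complex U"
    and "u \<in> vertices K" and "v \<in> vertices K"
  shows "same_contiguity_class U K (\<lambda>_. u) (\<lambda>_. v)"
proof -
  have nonempty: "s \<noteq> {}" if "s \<in> U" for s
    using that assms(3) by (auto simp: simplicial_complex_def)
  have const: "simplicial_map U K (\<lambda>_. x)" if "x \<in> vertices K" for x
  proof -
    have "{x} \<in> K"
      using that assms(1) by (auto simp: simplicial_complex_def vertices_def)
    then show ?thesis
      using nonempty by (simp add: simplicial_map_def image_constant_conv)
  qed
  have edge: "contiguous U K (\<lambda>_. x) (\<lambda>_. y)" if "{x, y} \<in> K" for x y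
    using that const[of x] const[of y] nonempty
    by (auto simp: contiguous_def vertices_def image_constant_conv insert_commute)
  have "(\<lambda>x y. {x, y} \<in> K)\<^sup>*\<^sup>* u v"
    using assms by (auto simp: connected_complex_def)
  then have "(contiguous U K)\<^sup>*\<^sup>* (\<lambda>_. u) (\<lambda>_. v)"
    by induction (auto intro: edge rtranclp.rtrancl_into_rtrancl)
  then show ?thesis
    using const[OF assms(4)] by (simp add: same_contiguity_class_def)
qed

section \<open>Maps into and out of the categorical product\<close>

lemma mem_cat_product_iff:
  "s \<in> cat_product K L \<longleftrightarrow> finite s \<and> fst ` s \<in> K \<and> snd ` s \<in> L"
  by (force simp: cat_product_def vertices_def)

lemma simplicial_map_fst: "simplicial_map (cat_product K L) K fst"
  and simplicial_map_snd: "simplicial_map (cat_product K L) L snd"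
  by (simp_all add: simplicial_map_def mem_cat_product_iff)

lemma same_contiguity_class_Pair_left:
  assumes "simplicial_complex X" and "simplicial_map X N p"
    and "same_contiguity_class X M f g"
  shows "same_contiguity_class X (cat_product M N) (\<lambda>x. (f x, p x)) (\<lambda>x. (g x, p x))"
proof (rule same_contiguity_class_map[where F = "\<lambda>f x. (f x, p x)", OF _ assms(3)])
  fix f g assume "contiguous X M f g"
  then show "contiguous X (cat_product M N) (\<lambda>x. (f x, p x)) (\<lambda>x. (g x, p x))"
    using assms(1,2)
    by (simp add: contiguous_def simplicial_map_def mem_cat_product_iff image_Un image_image
        simplicial_complex_def)
qed

section \<open>From categorical subcomplexes to motion planners\<close>

text \<open>
  The chain linking \<open>snd\<close> to \<open>fst\<close> runs through two constants: the point \<open>v\<close> to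
  which \<open>L\<close> contracts and the point \<open>u\<close> to which \<open>U\<close> contracts.
\<close>

lemma snd_planner_on_categorical_product:
  assumes K: "simplicial_complex K" "connected_complex K"
    and L: "categorical L K" and U: "categorical U K"
  shows "same_contiguity_class (cat_product U L) (cat_product K L)
    ((\<lambda>v. (v, v)) \<circ> snd) (\<lambda>x. x)"
proof -
  obtain v where v: "v \<in> vertices K" "same_contiguity_class L K (\<lambda>x. x) (\<lambda>_. v)"
    using L by (auto simp: categorical_def)
  obtain u where u: "u \<in> vertices K" "same_contiguity_class U K (\<lambda>x. x) (\<lambda>_. u)"
    using U by (auto simp: categorical_def)
  let ?\<Omega> = "cat_product U L"
  have \<Omega>: "simplicial_complex ?\<Omega>"
    using L U by (intro simplicial_complex_cat_product) (auto simp: categorical_def subcomplex_def)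
  have "same_contiguity_class ?\<Omega> K snd (\<lambda>_. v)"
    using same_contiguity_class_precompose[OF simplicial_map_snd v(2)] by (simp add: o_def)
  moreover have "same_contiguity_class ?\<Omega> K (\<lambda>_. v) (\<lambda>_. u)"
    by (rule constants_same_contiguity_class[OF K \<Omega> v(1) u(1)])
  moreover have "same_contiguity_class ?\<Omega> K (\<lambda>_. u) fst"
    using same_contiguity_class_precompose[OF simplicial_map_fst u(2), of L]
    by (simp add: o_def same_contiguity_class_sym)
  ultimately have "same_contiguity_class ?\<Omega> K snd fst"
    by (blast intro: same_contiguity_class_trans)
  from same_contiguity_class_Pair_left[OF \<Omega> simplicial_map_snd this]
  show ?thesis by (simp add: o_def)
qed

section \<open>From motion planners to categorical subcomplexes\<close>

definition slice :: "'b \<Rightarrow> ('a \<times> 'b) set set \<Rightarrow> 'a set set" where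
  "slice w \<Omega> = {s. (\<lambda>x. (x, w)) ` s \<in> \<Omega>}"

lemma simplicial_map_slice: "simplicial_map (slice w \<Omega>) \<Omega> (\<lambda>x. (x, w))"
  by (simp add: simplicial_map_def slice_def)

lemma subcomplex_slice:
  assumes "subcomplex \<Omega> (cat_product K L)"
  shows "subcomplex (slice w \<Omega>) K"
proof -
  have \<Omega>: "simplicial_complex \<Omega>" "\<Omega> \<subseteq> cat_product K L"
    using assms by (auto simp: subcomplex_def)
  have "slice w \<Omega> \<subseteq> K"
  proof
    fix s assume "s \<in> slice w \<Omega>"
    then have "fst ` (\<lambda>x. (x, w)) ` s \<in> K"
      using \<Omega>(2) by (auto simp: slice_def mem_cat_product_iff)
    then show "s \<in> K" by (simp add: image_image)
  qed
  moreover have "simplicial_complex (slice w \<Omega>)"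
    unfolding simplicial_complex_def
  proof (intro conjI ballI allI impI)
    fix s assume s: "s \<in> slice w \<Omega>"
    have "finite ((\<lambda>x. (x, w)) ` s)" "(\<lambda>x. (x, w)) ` s \<noteq> {}"
      using s \<Omega>(1) by (auto simp: slice_def simplicial_complex_def)
    then show "finite s" "s \<noteq> {}"
      by (auto dest: finite_imageD simp: inj_on_def)
    fix t assume "t \<subseteq> s \<and> t \<noteq> {}"
    then have "(\<lambda>x. (x, w)) ` t \<subseteq> (\<lambda>x. (x, w)) ` s" "(\<lambda>x. (x, w)) ` t \<noteq> {}"
      by auto
    then show "t \<in> slice w \<Omega>"
      using s \<Omega>(1) unfolding slice_def simplicial_complex_def by blast
  qed
  ultimately show ?thesis by (simp add: subcomplex_def)
qed

text \<open>
  Projecting the contiguity chain of the planner \<open>\<sigma>\<close> to the two factors links \<open>\<sigma>\<close> to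
  \<open>fst\<close> in \<open>K\<close> and to \<open>snd\<close> in \<open>L\<close>, hence in \<open>K\<close>. Restricted to
  the slice, \<open>fst\<close> becomes the inclusion and \<open>snd\<close> the constant \<open>w\<close>.
\<close>

lemma slice_categorical:
  assumes \<Omega>: "subcomplex \<Omega> (cat_product K L)"
    and \<sigma>: "same_contiguity_class \<Omega> (cat_product K L) ((\<lambda>v. (v, v)) \<circ> \<sigma>) (\<lambda>x. x)"
    and L: "L \<subseteq> K" and w: "w \<in> vertices L"
  shows "categorical (slice w \<Omega>) K"
proof -
  have snd: "simplicial_map (cat_product K L) K snd"
    using simplicial_map_snd[of K L] L by (auto simp: simplicial_map_def)
  have "same_contiguity_class \<Omega> K \<sigma> fst"
    using same_contiguity_class_postcompose[OF simplicial_map_fst \<sigma>] by (simp add: o_def)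
  moreover have "same_contiguity_class \<Omega> K \<sigma> snd"
    using same_contiguity_class_postcompose[OF snd \<sigma>] by (simp add: o_def)
  ultimately have "same_contiguity_class \<Omega> K fst snd"
    by (blast intro: same_contiguity_class_sym same_contiguity_class_trans)
  from same_contiguity_class_precompose[OF simplicial_map_slice this]
  have "same_contiguity_class (slice w \<Omega>) K (\<lambda>x. x) (\<lambda>_. w)"
    by (simp add: o_def)
  moreover have "w \<in> vertices K"
    using w L by (auto simp: vertices_def)
  ultimately show ?thesis
    using subcomplex_slice[OF \<Omega>] by (auto simp: categorical_def)
qed

section \<open>Equality of the two invariants\<close>

theorem theorem4p6:
  fixes K L :: "'a set set"
  assumes "simplicial_complex K" and "finite K" and "connected_complex K"
    and "categorical L K" and "L \<noteq> {}"
  shows "targeted_complexity K L = scat K"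
proof -
  let ?P = "cat_product K L"
  have L: "simplicial_complex L" "L \<subseteq> K"
    using assms(4) by (auto simp: categorical_def subcomplex_def)
  obtain w where w: "w \<in> vertices L" "{w} \<in> L"
    using assms(5) L(1) unfolding simplicial_complex_def vertices_def
    by (metis Union_iff bot.extremum_uniqueI empty_not_insert empty_subsetI equals0I
        insert_subset)
  let ?planned = "\<lambda>n \<Omega>. (\<forall>i\<le>n. subcomplex (\<Omega> i) ?P \<and>
      (\<exists>\<sigma>. simplicial_map (\<Omega> i) L \<sigma> \<and>
         same_contiguity_class (\<Omega> i) ?P ((\<lambda>v. (v, v)) \<circ> \<sigma>) (\<lambda>x. x))) \<and>
      (\<Union>i\<le>n. \<Omega> i) = ?P"
  let ?cat = "\<lambda>n U. (\<forall>i\<le>n. categorical (U i) K) \<and> (\<Union>i\<le>n. U i) = K"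
  have "(\<exists>\<Omega>. ?planned n \<Omega>) \<longleftrightarrow> (\<exists>U. ?cat n U)" for n :: nat
  proof
    assume "\<exists>U. ?cat n U"
    then obtain U where U: "\<And>i. i \<le> n \<Longrightarrow> categorical (U i) K" "(\<Union>i\<le>n. U i) = K"
      by blast
    have "subcomplex (cat_product (U i) L) ?P" if "i \<le> n" for i
    proof -
      have "simplicial_complex (U i)"
        using U(1)[OF that] by (auto simp: categorical_def subcomplex_def)
      moreover have "U i \<subseteq> K"
        using U(2) that by blast
      ultimately show ?thesis
        using L(1) by (auto simp: subcomplex_def mem_cat_product_iff
            intro: simplicial_complex_cat_product)
    qed
    moreover have "(\<Union>i\<le>n. cat_product (U i) L) = ?P"
      using U(2) by (auto simp: mem_cat_product_iff)
    ultimately have "?planned n (\<lambda>i. cat_product (U i) L)"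
      using snd_planner_on_categorical_product[OF assms(1,3,4) U(1)] simplicial_map_snd
      by blast
    then show "\<exists>\<Omega>. ?planned n \<Omega>" by (rule exI[where P = "?planned n"])
  next
    assume "\<exists>\<Omega>. ?planned n \<Omega>"
    then obtain \<Omega> where \<Omega>: "?planned n \<Omega>" by blast
    have "categorical (slice w (\<Omega> i)) K" if "i \<le> n" for i
      using \<Omega> that slice_categorical[OF _ _ L(2) w(1)] by blast
    moreover have "(\<Union>i\<le>n. slice w (\<Omega> i)) = K"
    proof
      show "(\<Union>i\<le>n. slice w (\<Omega> i)) \<subseteq> K"
        using \<Omega> subcomplex_slice by (fastforce simp: subcomplex_def)
      show "K \<subseteq> (\<Union>i\<le>n. slice w (\<Omega> i))"
      proof
        fix s assume s: "s \<in> K"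
        then have "finite s" "s \<noteq> {}"
          using assms(1) by (auto simp: simplicial_complex_def)
        then have "(\<lambda>x. (x, w)) ` s \<in> ?P"
          using s w(2) by (simp add: mem_cat_product_iff image_image image_constant_conv)
        then show "s \<in> (\<Union>i\<le>n. slice w (\<Omega> i))"
          using \<Omega> by (auto simp: slice_def)
      qed
    qed
    ultimately have "?cat n (\<lambda>i. slice w (\<Omega> i))" by blast
    then show "\<exists>U. ?cat n U" by (rule exI[where P = "?cat n"])
  qed
  then show ?thesis
    unfolding targeted_complexity_def scat_def by simp
qed

end
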